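(* Consider the $q$-$E_8^{(1)}$ equation $$\frac{\{g-G(\kappa_1/z)\}\{\underline g-\underline G(\kappa_1/z)\}}{\{g-G(z)\}\{\underline g-\underline G(z)\}}=\frac{U(\kappa_1/z)}{U(z)}\ \text{ for } f=F(z),\qquad \frac{\{f-F(\kappa_2/z)\}\{\overline f-\overline F(\kappa_2/z)\}}{\{f-F(z)\}\{\overline f-\overline F(z)\}}=\frac{U(\kappa_2/z)}{U(z)}\ \text{ for } g=G(z),$$ with the notation of the context. Then the following degenerations hold. (1) Replace $\kappa_i\to\varepsilon\kappa_i$ $(i=1,2)$, $v_j\to\varepsilon v_j$ $(j=1,\dots,4)$, $g\to 1/g$ (and $\underline g\to1/\underline g$). In the limit $\varepsilon\to0$ the equation becomes $$\frac{(fg-\frac{\kappa_1}{\kappa_2})(f\underline g-\frac{q\kappa_1}{\kappa_2})}{(fg-1)(f\underline g-1)}=\frac{\prod_{i=1}^4(f-\frac{\kappa_1}{v_i})}{\prod_{i=5}^8(f-v_i)},\qquad \frac{(fg-\frac{\kappa_1}{\kappa_2})(\overline fg-\frac{\kappa_1}{q\kappa_2})}{(fg-1)(\overline fg-1)}=\frac{\prod_{i=1}^4(g-\frac{v_i}{\kappa_2})}{\prod_{i=5}^8(g-\frac1{v_i})}.$$ (2) Replace $\kappa_1\to\varepsilon\kappa_1$, $v_i\to\varepsilon v_i$ $(i=1,2)$. In the limit $\varepsilon\to0$ the equation becomes $$\{g-G(f)\}\{\underline g-\underline G(f)\}=\frac{\prod_{i=3}^8(f-v_i)}{f^2\prod_{i=1}^2(f-\frac{\kappa_1}{v_i})},\qquad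 \frac{(f-\frac{\kappa_2}{z})(\overline f-\frac{\kappa_2}{z})}{(f-z)(\overline f-z)}=\frac{z^2}{(\frac{\kappa_2}{z})^2}\,\frac{\prod_{i=3}^8(\frac{\kappa_2}{z}-v_i)}{\prod_{i=3}^8(z-v_i)}\ \text{ for } g=G(z).$$ (3) Replace $v_1\to\varepsilon v_1$, $v_2\to\varepsilon^{-1}v_2$. In the limit $\varepsilon\to0$ the equation becomes the equation of the same form as the $q$-$E_8^{(1)}$ equation, with the same $F,G$, but with $U(z)$ replaced by $U(z)=z^{-3}\prod_{i=3}^8(z-v_i)$.
   Context: $q,\kappa_1,\kappa_2,v_1,\dots,v_8\in\mathbb C^\times$ are parameters with $\kappa_1^2\kappa_2^2=q\prod_{i=1}^8v_i$ (each of the three replacements preserves this constraint), and $f,g$ are dependent variables. The time evolution $T$ sends $v_i\mapsto v_i$, $\kappa_1\mapsto\kappa_1/q$, $\kappa_2\mapsto q\kappa_2$, $f\mapsto\overline f$, $g\mapsto\overline g$; in general $\overline X=T(X)$, $\underline X=T^{-1}(X)$. Here $$F(z)=z+\frac{\kappa_1}{z},\quad G(z)=z+\frac{\kappa_2}{z},\quad U(z)=z^{-4}\prod_{i=1}^8(z-v_i),$$ so $\overline F(z)=z+\frac{\kappa_1}{qz}$ and $\underline G(z)=z+\frac{\kappa_2}{qz}$. Each equation of the $q$-$E_8^{(1)}$ system is invariant under $z\leftrightarrow\kappa_1/z$ (first) or $z\leftrightarrow\kappa_2/z$ (second), so it does not depend on the choice of $z$. "In the limit $\varepsilon\to0$ the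 equation becomes" means: keep $f,g,\overline f,\underline g$ and the (new) parameters fixed and generic, take for $z$ a root of the (replaced) condition $f=F(z)$, resp. $g=G(z)$ (in cases where a parameter $\kappa_i$ tends to $0$, the root with nonzero limit); after multiplying both sides of an equation by a suitable common power of $\varepsilon$ ($\varepsilon^2$ for the first equation in (2), none otherwise), both sides converge, and equality of the limits is equivalent to the displayed equation. *)

theory Defs
  imports Complex_Main
begin

definition qF :: "complex \<Rightarrow> complex \<Rightarrow> complex" where
  "qF \<kappa>1 z = z + \<kappa>1 / z"

definition qG :: "complex \<Rightarrow> complex \<Rightarrow> complex" where
  "qG \<kappa>2 z = z + \<kappa>2 / z"

text \<open>Only the values of \<open>v\<close> at the indices 1 to 8 are used.\<close>

definition qU :: "(nat \<Rightarrow> complex) \<Rightarrow> complex \<Rightarrow> complex" where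
  "qU v z = z powi (-4) * (\<Prod>i=1..8. z - v i)"

text \<open>
  An equation is kept as the pair of its two sides, so that the sides can be passed to a limit
  separately.
\<close>

type_synonym equation = "complex \<times> complex"

definition holds :: "equation \<Rightarrow> bool" where
  "holds e \<longleftrightarrow> fst e = snd e"

text \<open>
  The two equations of the \<open>q\<close>-\<open>E\<^sub>8\<^sup>(\<^sup>1\<^sup>)\<close> system, with the function \<open>U\<close> as a parameter.
  The time evolution sends \<open>\<kappa>1\<close> to \<open>\<kappa>1 / q\<close> and \<open>\<kappa>2\<close> to \<open>q * \<kappa>2\<close>; hence overlined \<open>F\<close> is
  \<open>qF (\<kappa>1 / q)\<close> and underlined \<open>G\<close> is \<open>qG (\<kappa>2 / q)\<close>. The variable \<open>gu\<close> is underlined \<open>g\<close>, and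
  \<open>fo\<close> is overlined \<open>f\<close>. The side conditions \<open>f = qF \<kappa>1 z\<close> and \<open>g = qG \<kappa>2 z\<close>, respectively, are
  not part of the definitions.
\<close>

definition E8_eq1 ::
  "complex \<Rightarrow> complex \<Rightarrow> complex \<Rightarrow> (complex \<Rightarrow> complex) \<Rightarrow>
   complex \<Rightarrow> complex \<Rightarrow> complex \<Rightarrow> equation" where
  "E8_eq1 q \<kappa>1 \<kappa>2 U g gu z =
     (((g - qG \<kappa>2 (\<kappa>1 / z)) * (gu - qG (\<kappa>2 / q) (\<kappa>1 / z))) /
        ((g - qG \<kappa>2 z) * (gu - qG (\<kappa>2 / q) z)),
      U (\<kappa>1 / z) / U z)"

definition E8_eq2 ::
  "complex \<Rightarrow> complex \<Rightarrow> complex \<Rightarrow> (complex \<Rightarrow> complex) \<Rightarrow>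
   complex \<Rightarrow> complex \<Rightarrow> complex \<Rightarrow> equation" where
  "E8_eq2 q \<kappa>1 \<kappa>2 U f fo z =
     (((f - qF \<kappa>1 (\<kappa>2 / z)) * (fo - qF (\<kappa>1 / q) (\<kappa>2 / z))) /
        ((f - qF \<kappa>1 z) * (fo - qF (\<kappa>1 / q) z)),
      U (\<kappa>2 / z) / U z)"

text \<open>
  \<open>z\<close> is a branch, for small nonzero \<open>\<epsilon>\<close>, of roots of \<open>w = \<Phi> \<epsilon> (z \<epsilon>)\<close> with a nonzero limit.
\<close>

definition nonzero_root :: "(complex \<Rightarrow> complex \<Rightarrow> complex) \<Rightarrow> complex \<Rightarrow> (complex \<Rightarrow> complex) \<Rightarrow> bool" where
  "nonzero_root \<Phi> w z \<longleftrightarrow>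
     (\<forall>\<^sub>F \<epsilon> in at 0. w = \<Phi> \<epsilon> (z \<epsilon>)) \<and> (\<exists>z0. z0 \<noteq> 0 \<and> (z \<longlongrightarrow> z0) (at 0))"

text \<open>
  After multiplication by \<open>\<epsilon> ^ n\<close> both sides of \<open>e \<epsilon>\<close> converge, and equality of the two limits is
  equivalent to \<open>P\<close>.
\<close>

definition becomes :: "nat \<Rightarrow> (complex \<Rightarrow> equation) \<Rightarrow> bool \<Rightarrow> bool" where
  "becomes n e P \<longleftrightarrow>
     (\<exists>l r. ((\<lambda>\<epsilon>. \<epsilon> ^ n * fst (e \<epsilon>)) \<longlongrightarrow> l) (at 0) \<and>
            ((\<lambda>\<epsilon>. \<epsilon> ^ n * snd (e \<epsilon>)) \<longlongrightarrow> r) (at 0) \<and>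
            (l = r \<longleftrightarrow> P))"

end

theory Submission
  imports Defs "HOL-Analysis.Complex_Transcendental"
begin

text \<open>
  A root \<open>z\<close> of \<open>w = z + \<epsilon> \<kappa> / z\<close> with nonzero limit tends to \<open>w\<close>, while its partner \<open>\<epsilon> \<kappa> / z\<close>
  is of order \<open>\<epsilon>\<close>; with this, both sides of each equation converge by continuity. For the first
  equations in (1) and (2) the constraint \<open>\<kappa>1\<^sup>2 \<kappa>2\<^sup>2 = q \<Prod> v\<^sub>i\<close> makes the constant factors of the
  two limits agree. In (3) the factors with \<open>v\<^sub>1\<close> and \<open>v\<^sub>2\<close> contribute just \<open>(\<kappa> / z) / z\<close> to the
  limit of \<open>U(\<kappa> / z) / U(z)\<close>, which lowers the exponent of \<open>z\<close> from 4 to 3.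
\<close>

section \<open>Branches of roots with a nonzero limit\<close>

text \<open>F and G have the same shape, so the facts about roots proved for \<open>qF\<close> serve
  for \<open>qG\<close> as well.\<close>

lemma qG_eq_qF: "qG = qF"
  by (simp add: fun_eq_iff qF_def qG_def)

text \<open>The quadratic formula for z^2 - w z + \<epsilon> \<kappa> = 0, with the sign for which
  the root tends to w instead of 0. This keeps the later claims about all such branches from being
  vacuous.\<close>

lemma nonzero_root_exists:
  assumes "w \<noteq> 0"
  shows "\<exists>z. nonzero_root (\<lambda>\<epsilon>. qF (\<epsilon> * \<kappa>)) w z"
proof
  \<comment> \<open>Taking w out of the square root moves the argument of \<open>csqrt\<close> close
    to 1, away from the branch cut, whatever w is.\<close>
  let ?z = "\<lambda>\<epsilon>. w / 2 * (1 + csqrt (1 - 4 * \<epsilon> * \<kappa> / w\<^sup>2))"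
  have cont: "isCont csqrt 1"
    by (rule continuous_at_csqrt) auto
  have "((\<lambda>\<epsilon>. 1 - 4 * \<epsilon> * \<kappa> / w\<^sup>2) \<longlongrightarrow> 1) (at 0)"
    using assms by (auto intro!: tendsto_eq_intros)
  from isCont_tendsto_compose[OF cont this]
  have s: "((\<lambda>\<epsilon>. csqrt (1 - 4 * \<epsilon> * \<kappa> / w\<^sup>2)) \<longlongrightarrow> 1) (at 0)"
    by simp
  have "(?z \<longlongrightarrow> w / 2 * (1 + 1)) (at 0)"
    by (intro tendsto_intros s)
  then have lim: "(?z \<longlongrightarrow> w) (at 0)"
    by simp
  have "\<forall>\<^sub>F \<epsilon> in at 0. ?z \<epsilon> \<noteq> 0"
    using lim assms by (rule tendsto_imp_eventually_ne)
  then have "\<forall>\<^sub>F \<epsilon> in at 0. w = qF (\<epsilon> * \<kappa>) (?z \<epsilon>)"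
  proof eventually_elim
    case (elim \<epsilon>)
    define s where "s = csqrt (1 - 4 * \<epsilon> * \<kappa> / w\<^sup>2)"
    have "s\<^sup>2 = 1 - 4 * \<epsilon> * \<kappa> / w\<^sup>2"
      by (simp add: s_def)
    \<comment> \<open>The aim is Vieta's relation: \<epsilon> \<kappa> is the product of the chosen
      root and its partner, the latter being w minus the former.\<close>
    then have "\<epsilon> * \<kappa> = w\<^sup>2 * (1 - s\<^sup>2) / 4"
      using assms by (simp add: field_simps)
    also have "\<dots> = (w - w / 2 * (1 + s)) * (w / 2 * (1 + s))"
      by (simp add: field_simps power2_eq_square)
    finally show ?case
      using elim by (simp add: qF_def flip: s_def)
  qed
  with lim assms show "nonzero_root (\<lambda>\<epsilon>. qF (\<epsilon> * \<kappa>)) w ?z"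
    unfolding nonzero_root_def by blast
qed

text \<open>As the limit \<open>z0\<close> is nonzero, \<epsilon> \<kappa> / z tends to 0, so the
  constant w tends to \<open>z0\<close> and equals it by uniqueness of limits.\<close>

lemma nonzero_root_limit:
  assumes "nonzero_root (\<lambda>\<epsilon>. qF (\<epsilon> * \<kappa>)) w z"
  shows "(z \<longlongrightarrow> w) (at 0)"
proof -
  from assms obtain z0 where z0: "z0 \<noteq> 0" "(z \<longlongrightarrow> z0) (at 0)"
    and ev: "\<forall>\<^sub>F \<epsilon> in at 0. w = qF (\<epsilon> * \<kappa>) (z \<epsilon>)"
    unfolding nonzero_root_def by blast
  have "((\<lambda>\<epsilon>. qF (\<epsilon> * \<kappa>) (z \<epsilon>)) \<longlongrightarrow> z0) (at 0)"
    unfolding qF_def using z0 by (auto intro!: tendsto_eq_intros)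
  then have "((\<lambda>\<epsilon>::complex. w) \<longlongrightarrow> z0) (at 0)"
    by (rule Lim_transform_eventually) (use ev in \<open>simp add: eq_commute\<close>)
  then have "w = z0"
    using LIM_const_eq by blast
  with z0 show ?thesis by simp
qed

section \<open>The ratio of values of U under scaling of the parameters\<close>

text \<open>Separates the scaled factors from the others, for use with m = 4 in (1) and m = 2 in
  (2).\<close>

lemma prod_scaled_split:
  fixes v :: "nat \<Rightarrow> complex"
  assumes "m \<le> 8"
  shows "(\<Prod>i=1..8. w - (if i \<in> {1..m} then \<epsilon> * v i else v i)) =
    (\<Prod>i=1..m. w - \<epsilon> * v i) * (\<Prod>i=Suc m..8. w - v i)"
proof -
  have "{1..8} = {1..m} \<union> {Suc m..8}" using assms by auto
  then show ?thesis by (simp add: prod.union_disjoint)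
qed

text \<open>If z or w is 0, both sides are 0 by the convention for division by zero.\<close>

lemma qU_ratio:
  "qU v w / qU v z = (z / w) ^ 4 * ((\<Prod>i=1..8. w - v i) / (\<Prod>i=1..8. z - v i))"
  by (simp add: qU_def power_int_minus field_simps)

text \<open>The numerator has m scaled factors, each of order \<epsilon>, while the fourth power of
  z / (\<epsilon> \<kappa> / z) has a pole of order 4; the factor
  \<open>\<epsilon> ^ (4 - m)\<close> compensates exactly. The unscaled factors of the numerator
  tend to -v_i and complete the product of all v_i.\<close>

lemma qU_ratio_scaled_limit:
  fixes v :: "nat \<Rightarrow> complex"
  assumes m: "m \<le> 4" and z: "(z \<longlongrightarrow> z0) (at 0)" and nz: "z0 \<noteq> 0" "\<kappa> \<noteq> 0"
    and v: "\<forall>i\<in>{1..8}. v i \<noteq> 0" and ne: "\<forall>i\<in>{Suc m..8}. z0 \<noteq> v i"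
  defines "V \<equiv> \<lambda>\<epsilon> i. if i \<in> {1..m} then \<epsilon> * v i else v i"
  shows "((\<lambda>\<epsilon>. \<epsilon> ^ (4 - m) * (qU (V \<epsilon>) (\<epsilon> * \<kappa> / z \<epsilon>) / qU (V \<epsilon>) (z \<epsilon>))) \<longlongrightarrow>
    z0 ^ (8 - 2 * m) / \<kappa> ^ 4 * (\<Prod>i=1..8. v i) *
    ((\<Prod>i=1..m. z0 - \<kappa> / v i) / (\<Prod>i=Suc m..8. z0 - v i))) (at 0)"
    (is "(?L \<longlongrightarrow> ?l) _")
proof -
  \<comment> \<open>\<open>?R\<close> is \<open>?L\<close> with the powers of \<epsilon> cancelled,
    hence continuous at 0. In \<open>?r\<close> the terms with factor 0 stay unsimplified so that
    the limit rules match literally.\<close>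
  let ?R = "\<lambda>\<epsilon>. z \<epsilon> ^ 8 / \<kappa> ^ 4 *
    ((\<Prod>i=1..m. \<kappa> / z \<epsilon> - v i) * (\<Prod>i=Suc m..8. \<epsilon> * \<kappa> / z \<epsilon> - v i) /
     ((\<Prod>i=1..m. z \<epsilon> - \<epsilon> * v i) * (\<Prod>i=Suc m..8. z \<epsilon> - v i)))"
  let ?r = "z0 ^ 8 / \<kappa> ^ 4 *
    ((\<Prod>i=1..m. \<kappa> / z0 - v i) * (\<Prod>i=Suc m..8. 0 * \<kappa> / z0 - v i) /
     ((\<Prod>i=1..m. z0 - 0 * v i) * (\<Prod>i=Suc m..8. z0 - v i)))"
  have "(?R \<longlongrightarrow> ?r) (at 0)"
    using nz ne by (intro tendsto_intros z) (auto simp: prod_zero_iff)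
  moreover have "\<forall>\<^sub>F \<epsilon> in at 0. ?R \<epsilon> = ?L \<epsilon>"
    using tendsto_imp_eventually_ne[OF z nz(1)] eventually_neq_at_within[of 0 0 UNIV]
  proof eventually_elim
    case (elim \<epsilon>)
    have "(\<Prod>i=1..m. \<epsilon> * \<kappa> / z \<epsilon> - \<epsilon> * v i) = (\<Prod>i=1..m. \<epsilon> * (\<kappa> / z \<epsilon> - v i))"
      by (simp add: algebra_simps)
    also have "\<dots> = \<epsilon> ^ m * (\<Prod>i=1..m. \<kappa> / z \<epsilon> - v i)"
      by (simp add: prod.distrib)
    finally have scale: "(\<Prod>i=1..m. \<epsilon> * \<kappa> / z \<epsilon> - \<epsilon> * v i) =
      \<epsilon> ^ m * (\<Prod>i=1..m. \<kappa> / z \<epsilon> - v i)" .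
    have "\<epsilon> ^ (4 - m) * \<epsilon> ^ m = \<epsilon> ^ 4"
      using m by (simp flip: power_add)
    then have cancel: "\<epsilon> ^ (4 - m) * \<epsilon> ^ m / \<epsilon> ^ 4 = 1"
      using elim by simp
    have "(z \<epsilon> / (\<epsilon> * \<kappa> / z \<epsilon>)) ^ 4 = z \<epsilon> ^ 8 / (\<epsilon> ^ 4 * \<kappa> ^ 4)"
      by (simp add: power_divide power_mult_distrib flip: power_add)
    then have "\<epsilon> ^ (4 - m) * ((z \<epsilon> / (\<epsilon> * \<kappa> / z \<epsilon>)) ^ 4 * ((\<epsilon> ^ m * A * B) / C)) =
      \<epsilon> ^ (4 - m) * \<epsilon> ^ m / \<epsilon> ^ 4 * (z \<epsilon> ^ 8 / \<kappa> ^ 4 * (A * B / C))" for A B C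
      by (simp add: mult_ac)
    note this[unfolded cancel mult_1_left]
    then show ?case
      unfolding qU_ratio V_def using m by (simp only: prod_scaled_split scale)
  qed
  ultimately have "(?L \<longlongrightarrow> ?r) (at 0)"
    by (rule Lim_transform_eventually)
  moreover have "?r = ?l"
  proof -
    \<comment> \<open>Each factor is rewritten as a polynomial in \<open>z0\<close> with zero at
      \<kappa> / v_i, at the cost of a factor -v_i / \<open>z0\<close>.\<close>
    have "(\<Prod>i=1..m. \<kappa> / z0 - v i) = (\<Prod>i=1..m. - v i * ((z0 - \<kappa> / v i) / z0))"
      using m v nz by (intro prod.cong) (auto simp: field_simps)
    also have "\<dots> = (\<Prod>i=1..m. - v i) * ((\<Prod>i=1..m. z0 - \<kappa> / v i) / z0 ^ m)"
      unfolding prod.distrib prod_dividef by simp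
    finally have a: "(\<Prod>i=1..m. \<kappa> / z0 - v i) =
      (\<Prod>i=1..m. - v i) * ((\<Prod>i=1..m. z0 - \<kappa> / v i) / z0 ^ m)" .
    \<comment> \<open>The factors -v_i from the scaled and the unscaled part combine; eight minus
      signs cancel.\<close>
    have "{1..8} = {1..m} \<union> {Suc m..8}" using m by auto
    then have "(\<Prod>i=1..m. - v i) * (\<Prod>i=Suc m..8. - v i) = (\<Prod>i=1..8. - v i)"
      by (simp add: prod.union_disjoint)
    also have "\<dots> = (\<Prod>i=1..8. v i)"
      by (simp add: prod_uminus)
    finally have b: "(\<Prod>i=1..m. - v i) * (\<Prod>i=Suc m..8. - v i) = (\<Prod>i=1..8. v i)" .
    \<comment> \<open>One power \<open>z0 ^ m\<close> is used by the scaled factors of the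
      numerator, the other by those of the denominator.\<close>
    have "z0 ^ 8 = z0 ^ (8 - 2 * m) * (z0 ^ m * z0 ^ m)"
      using m by (simp flip: power_add)
    then show ?thesis
      using nz unfolding a b[symmetric] by simp
  qed
  ultimately show ?thesis by simp
qed

section \<open>Degeneration (1): both \<kappa>_i and four v_j scaled, g inverted\<close>

text \<open>Both limits are the displayed sides times the same nonzero constant \<open>c\<close>. On
  the left it comes from the leading coefficients in the numerator, on the right it is the product
  of all v_i over \<kappa>_1^4, which the constraint identifies with \<open>c\<close>.\<close>

lemma degeneration1_eq1:
  fixes v :: "nat \<Rightarrow> complex"
  assumes nz: "q \<noteq> 0" "\<kappa>1 \<noteq> 0" "\<kappa>2 \<noteq> 0" "\<forall>i\<in>{1..8}. v i \<noteq> 0"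
    and bal: "\<kappa>1^2 * \<kappa>2^2 = q * (\<Prod>i=1..8. v i)"
    and gen: "f \<noteq> 0" "g \<noteq> 0" "gu \<noteq> 0" "f * g \<noteq> 1" "f * gu \<noteq> 1" "\<forall>i\<in>{5..8}. f \<noteq> v i"
    and root: "nonzero_root (\<lambda>\<epsilon>. qF (\<epsilon> * \<kappa>1)) f z"
  shows "becomes 0
    (\<lambda>\<epsilon>. E8_eq1 q (\<epsilon> * \<kappa>1) (\<epsilon> * \<kappa>2)
            (qU (\<lambda>j. if j \<in> {1..4} then \<epsilon> * v j else v j)) (1 / g) (1 / gu) (z \<epsilon>))
    (((f * g - \<kappa>1 / \<kappa>2) * (f * gu - q * \<kappa>1 / \<kappa>2)) / ((f * g - 1) * (f * gu - 1)) =
     (\<Prod>i=1..4. f - \<kappa>1 / v i) / (\<Prod>i=5..8. f - v i))"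
proof -
  note z = nonzero_root_limit[OF root]
  define X where "X = ((f * g - \<kappa>1 / \<kappa>2) * (f * gu - q * \<kappa>1 / \<kappa>2)) / ((f * g - 1) * (f * gu - 1))"
  define Y where "Y = (\<Prod>i=1..4. f - \<kappa>1 / v i) / (\<Prod>i=5..8. f - v i)"
  define c where "c = \<kappa>2\<^sup>2 / (q * \<kappa>1\<^sup>2)"
  have c: "c \<noteq> 0" using nz by (simp add: c_def)
  have ne: "1 / g \<noteq> f" "1 / gu \<noteq> f" using gen by (auto simp: field_simps)
  let ?L = "\<lambda>\<epsilon>. ((1 / g - qG (\<epsilon> * \<kappa>2) (\<epsilon> * \<kappa>1 / z \<epsilon>)) *
      (1 / gu - qG (\<epsilon> * \<kappa>2 / q) (\<epsilon> * \<kappa>1 / z \<epsilon>))) /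
    ((1 / g - qG (\<epsilon> * \<kappa>2) (z \<epsilon>)) * (1 / gu - qG (\<epsilon> * \<kappa>2 / q) (z \<epsilon>)))"
  \<comment> \<open>In G(\<epsilon> \<kappa>_1 / z) the term \<epsilon> \<kappa>_2 / (\<epsilon>
    \<kappa>_1 / z) is independent of \<epsilon> apart from z; only this cancellation separates
    \<open>?R\<close> from \<open>?L\<close>.\<close>
  let ?R = "\<lambda>\<epsilon>. ((1 / g - (\<epsilon> * \<kappa>1 / z \<epsilon> + \<kappa>2 * z \<epsilon> / \<kappa>1)) *
      (1 / gu - (\<epsilon> * \<kappa>1 / z \<epsilon> + \<kappa>2 * z \<epsilon> / (q * \<kappa>1)))) /
    ((1 / g - (z \<epsilon> + \<epsilon> * \<kappa>2 / z \<epsilon>)) * (1 / gu - (z \<epsilon> + \<epsilon> * \<kappa>2 / q / z \<epsilon>)))"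
  have "(?R \<longlongrightarrow> ((1 / g - (0 * \<kappa>1 / f + \<kappa>2 * f / \<kappa>1)) * (1 / gu - (0 * \<kappa>1 / f + \<kappa>2 * f / (q * \<kappa>1)))) /
     ((1 / g - (f + 0 * \<kappa>2 / f)) * (1 / gu - (f + 0 * \<kappa>2 / q / f)))) (at 0)"
    using nz gen ne by (intro tendsto_intros z) auto
  also have "((1 / g - (0 * \<kappa>1 / f + \<kappa>2 * f / \<kappa>1)) * (1 / gu - (0 * \<kappa>1 / f + \<kappa>2 * f / (q * \<kappa>1)))) /
     ((1 / g - (f + 0 * \<kappa>2 / f)) * (1 / gu - (f + 0 * \<kappa>2 / q / f))) = c * X"
  proof -
    \<comment> \<open>Numerator and denominator both acquire 1 / (g \<open>gu\<close>), which
      cancels; the remaining coefficients multiply to \<open>c\<close>.\<close>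
    have "1 / g - \<kappa>2 * f / \<kappa>1 = - (\<kappa>2 / \<kappa>1) * ((f * g - \<kappa>1 / \<kappa>2) / g)"
      and "1 / gu - \<kappa>2 * f / (q * \<kappa>1) = - (\<kappa>2 / (q * \<kappa>1)) * ((f * gu - q * \<kappa>1 / \<kappa>2) / gu)"
      and "1 / g - f = - ((f * g - 1) / g)" and "1 / gu - f = - ((f * gu - 1) / gu)"
      using nz gen by (simp_all add: field_simps)
    then show ?thesis
      using gen by (simp add: X_def c_def power2_eq_square mult_ac)
  qed
  finally have "(?R \<longlongrightarrow> c * X) (at 0)" .
  moreover have "\<forall>\<^sub>F \<epsilon> in at 0. ?R \<epsilon> = ?L \<epsilon>"
    using tendsto_imp_eventually_ne[OF z gen(1)] eventually_neq_at_within[of 0 0 UNIV]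
    by eventually_elim (simp add: qG_def)
  ultimately have l: "(?L \<longlongrightarrow> c * X) (at 0)"
    by (rule Lim_transform_eventually)
  have "\<kappa>1\<^sup>2 * c * \<kappa>1\<^sup>2 = (\<Prod>i=1..8. v i)"
    using bal nz by (simp add: c_def field_simps)
  then have "(\<Prod>i=1..8. v i) / \<kappa>1 ^ 4 = c"
    using nz by (auto simp: field_simps simp flip: power_add)
  then have r: "((\<lambda>\<epsilon>. qU (\<lambda>j. if j \<in> {1..4} then \<epsilon> * v j else v j) (\<epsilon> * \<kappa>1 / z \<epsilon>) /
      qU (\<lambda>j. if j \<in> {1..4} then \<epsilon> * v j else v j) (z \<epsilon>)) \<longlongrightarrow> c * Y) (at 0)"
    using qU_ratio_scaled_limit[of 4 z f \<kappa>1 v] z nz gen by (simp add: Y_def)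
  have "c * X = c * Y \<longleftrightarrow> X = Y" using c by simp
  with l r show ?thesis
    unfolding becomes_def E8_eq1_def fst_conv snd_conv power_0 mult_1_left X_def Y_def by blast
qed

text \<open>Here z tends to 1 / g. Rewriting the limit of the U ratio in g yields constants that
  cancel its prefactor, so the two limits are exactly the displayed sides.\<close>

lemma degeneration1_eq2:
  fixes v :: "nat \<Rightarrow> complex"
  assumes nz: "q \<noteq> 0" "\<kappa>1 \<noteq> 0" "\<kappa>2 \<noteq> 0" "\<forall>i\<in>{1..8}. v i \<noteq> 0"
    and gen: "g \<noteq> 0" "f * g \<noteq> 1" "fo * g \<noteq> 1" "\<forall>i\<in>{5..8}. g \<noteq> 1 / v i"
    and root: "nonzero_root (\<lambda>\<epsilon>. qG (\<epsilon> * \<kappa>2)) (1 / g) z"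
  shows "becomes 0
    (\<lambda>\<epsilon>. E8_eq2 q (\<epsilon> * \<kappa>1) (\<epsilon> * \<kappa>2)
            (qU (\<lambda>j. if j \<in> {1..4} then \<epsilon> * v j else v j)) f fo (z \<epsilon>))
    (((f * g - \<kappa>1 / \<kappa>2) * (fo * g - \<kappa>1 / (q * \<kappa>2))) / ((f * g - 1) * (fo * g - 1)) =
     (\<Prod>i=1..4. g - v i / \<kappa>2) / (\<Prod>i=5..8. g - 1 / v i))"
proof -
  note z = nonzero_root_limit[OF root[unfolded qG_eq_qF]]
  define X where "X = ((f * g - \<kappa>1 / \<kappa>2) * (fo * g - \<kappa>1 / (q * \<kappa>2))) / ((f * g - 1) * (fo * g - 1))"
  define Y where "Y = (\<Prod>i=1..4. g - v i / \<kappa>2) / (\<Prod>i=5..8. g - 1 / v i)"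
  have ne: "f \<noteq> 1 / g" "fo \<noteq> 1 / g" "1 / g \<noteq> 0" using gen by (auto simp: field_simps)
  have nev: "\<forall>i\<in>{Suc 4..8}. 1 / g \<noteq> v i" using nz gen by (auto simp: field_simps)
  let ?L = "\<lambda>\<epsilon>. ((f - qF (\<epsilon> * \<kappa>1) (\<epsilon> * \<kappa>2 / z \<epsilon>)) *
      (fo - qF (\<epsilon> * \<kappa>1 / q) (\<epsilon> * \<kappa>2 / z \<epsilon>))) /
    ((f - qF (\<epsilon> * \<kappa>1) (z \<epsilon>)) * (fo - qF (\<epsilon> * \<kappa>1 / q) (z \<epsilon>)))"
  let ?R = "\<lambda>\<epsilon>. ((f - (\<epsilon> * \<kappa>2 / z \<epsilon> + \<kappa>1 * z \<epsilon> / \<kappa>2)) *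
      (fo - (\<epsilon> * \<kappa>2 / z \<epsilon> + \<kappa>1 * z \<epsilon> / (q * \<kappa>2)))) /
    ((f - (z \<epsilon> + \<epsilon> * \<kappa>1 / z \<epsilon>)) * (fo - (z \<epsilon> + \<epsilon> * \<kappa>1 / q / z \<epsilon>)))"
  let ?z = "1 / g"
  have "(?R \<longlongrightarrow> ((f - (0 * \<kappa>2 / ?z + \<kappa>1 * ?z / \<kappa>2)) * (fo - (0 * \<kappa>2 / ?z + \<kappa>1 * ?z / (q * \<kappa>2)))) /
     ((f - (?z + 0 * \<kappa>1 / ?z)) * (fo - (?z + 0 * \<kappa>1 / q / ?z)))) (at 0)"
    using nz gen ne by (intro tendsto_intros z) auto
  also have "((f - (0 * \<kappa>2 / ?z + \<kappa>1 * ?z / \<kappa>2)) * (fo - (0 * \<kappa>2 / ?z + \<kappa>1 * ?z / (q * \<kappa>2)))) /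
     ((f - (?z + 0 * \<kappa>1 / ?z)) * (fo - (?z + 0 * \<kappa>1 / q / ?z))) = X"
  proof -
    have "f - \<kappa>1 * ?z / \<kappa>2 = (f * g - \<kappa>1 / \<kappa>2) / g"
      and "fo - \<kappa>1 * ?z / (q * \<kappa>2) = (fo * g - \<kappa>1 / (q * \<kappa>2)) / g"
      and "f - ?z = (f * g - 1) / g" and "fo - ?z = (fo * g - 1) / g"
      using nz gen by (simp_all add: field_simps)
    then show ?thesis
      using gen by (simp add: X_def)
  qed
  finally have "(?R \<longlongrightarrow> X) (at 0)" .
  moreover have "\<forall>\<^sub>F \<epsilon> in at 0. ?R \<epsilon> = ?L \<epsilon>"
    using tendsto_imp_eventually_ne[OF z ne(3)] eventually_neq_at_within[of 0 0 UNIV]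
    by eventually_elim (simp add: qF_def)
  ultimately have l: "(?L \<longlongrightarrow> X) (at 0)"
    by (rule Lim_transform_eventually)
  have "((\<Prod>i=1..8. v i) / \<kappa>2 ^ 4) * ((\<Prod>i=1..4. ?z - \<kappa>2 / v i) / (\<Prod>i=5..8. ?z - v i)) = Y"
  proof -
    \<comment> \<open>Passing from 1 / g to g inverts the zeros. The even number of factors removes
      the signs, and the powers \<open>g ^ 4\<close> from this product and the next cancel in the
      quotient.\<close>
    have "(\<Prod>i=1..4. ?z - \<kappa>2 / v i) = (\<Prod>i=1..4. - (\<kappa>2 / g) * ((g - v i / \<kappa>2) / v i))"
      using nz gen by (intro prod.cong) (auto simp: field_simps)
    also have "\<dots> = \<kappa>2 ^ 4 / g ^ 4 * ((\<Prod>i=1..4. g - v i / \<kappa>2) / (\<Prod>i=1..4. v i))"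
      unfolding prod.distrib prod_dividef by (simp add: power_divide)
    finally have a: "(\<Prod>i=1..4. ?z - \<kappa>2 / v i) =
      \<kappa>2 ^ 4 / g ^ 4 * ((\<Prod>i=1..4. g - v i / \<kappa>2) / (\<Prod>i=1..4. v i))" .
    have "(\<Prod>i=5..8. ?z - v i) = (\<Prod>i=5..8. - (1 / g) * (v i * (g - 1 / v i)))"
      using nz gen by (intro prod.cong) (auto simp: field_simps)
    also have "\<dots> = 1 / g ^ 4 * ((\<Prod>i=5..8. v i) * (\<Prod>i=5..8. g - 1 / v i))"
      unfolding prod.distrib by (simp add: power_divide)
    finally have b: "(\<Prod>i=5..8. ?z - v i) =
      1 / g ^ 4 * ((\<Prod>i=5..8. v i) * (\<Prod>i=5..8. g - 1 / v i))" .
    have "{1..8} = {1..4} \<union> {5..8::nat}" by auto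
    then have s: "(\<Prod>i=1..8. v i) = (\<Prod>i=1..4. v i) * (\<Prod>i=5..8. v i)"
      by (simp add: prod.union_disjoint)
    have "(\<Prod>i=1..4. v i) \<noteq> 0" "(\<Prod>i=5..8. v i) \<noteq> 0"
      using nz by auto
    then show ?thesis
      using nz gen unfolding a b s Y_def by simp
  qed
  then have r: "((\<lambda>\<epsilon>. qU (\<lambda>j. if j \<in> {1..4} then \<epsilon> * v j else v j) (\<epsilon> * \<kappa>2 / z \<epsilon>) /
      qU (\<lambda>j. if j \<in> {1..4} then \<epsilon> * v j else v j) (z \<epsilon>)) \<longlongrightarrow> Y) (at 0)"
    using qU_ratio_scaled_limit[of 4 z ?z \<kappa>2 v, OF _ z ne(3) nz(3) nz(4) nev] by simp
  from l r show ?thesis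
    unfolding becomes_def E8_eq2_def fst_conv snd_conv power_0 mult_1_left X_def Y_def by blast
qed

section \<open>Degeneration (2): \<kappa>_1, v_1 and v_2 scaled\<close>

text \<open>With \<kappa>_2 fixed, G(\<epsilon> \<kappa>_1 / z) and its underlined version have
  simple poles in \<epsilon>, and the U ratio has a double pole; this is why both sides are
  multiplied by \<epsilon>^2.\<close>

lemma degeneration2_eq1:
  fixes v :: "nat \<Rightarrow> complex"
  assumes nz: "q \<noteq> 0" "\<kappa>1 \<noteq> 0" "\<kappa>2 \<noteq> 0" "\<forall>i\<in>{1..8}. v i \<noteq> 0"
    and bal: "\<kappa>1^2 * \<kappa>2^2 = q * (\<Prod>i=1..8. v i)"
    and gen: "f \<noteq> 0" "g \<noteq> qG \<kappa>2 f" "gu \<noteq> qG (\<kappa>2 / q) f"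
      "\<forall>i\<in>{1..2}. f \<noteq> \<kappa>1 / v i" "\<forall>i\<in>{3..8}. f \<noteq> v i"
    and root: "nonzero_root (\<lambda>\<epsilon>. qF (\<epsilon> * \<kappa>1)) f z"
  shows "becomes 2
    (\<lambda>\<epsilon>. E8_eq1 q (\<epsilon> * \<kappa>1) \<kappa>2
            (qU (\<lambda>i. if i \<in> {1..2} then \<epsilon> * v i else v i)) g gu (z \<epsilon>))
    ((g - qG \<kappa>2 f) * (gu - qG (\<kappa>2 / q) f) =
     (\<Prod>i=3..8. f - v i) / (f^2 * (\<Prod>i=1..2. f - \<kappa>1 / v i)))"
proof -
  note z = nonzero_root_limit[OF root]
  define A where "A = (g - qG \<kappa>2 f) * (gu - qG (\<kappa>2 / q) f)"
  define B where "B = (\<Prod>i=1..2. f - \<kappa>1 / v i)"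
  define C where "C = (\<Prod>i=3..8. f - v i)"
  \<comment> \<open>\<open>c\<close> is the product of the limits \<kappa>_2 f / \<kappa>_1 and
    \<kappa>_2 f / (q \<kappa>_1) of \<epsilon> times the two diverging values of G.\<close>
  define c where "c = \<kappa>2\<^sup>2 * f\<^sup>2 / (q * \<kappa>1\<^sup>2)"
  have ABC: "A \<noteq> 0" "B \<noteq> 0" "C \<noteq> 0" using gen by (auto simp: A_def B_def C_def)
  have c: "c \<noteq> 0" using nz gen by (simp add: c_def)
  let ?L = "\<lambda>\<epsilon>. \<epsilon>\<^sup>2 * (((g - qG \<kappa>2 (\<epsilon> * \<kappa>1 / z \<epsilon>)) * (gu - qG (\<kappa>2 / q) (\<epsilon> * \<kappa>1 / z \<epsilon>))) /
    ((g - qG \<kappa>2 (z \<epsilon>)) * (gu - qG (\<kappa>2 / q) (z \<epsilon>))))"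
  \<comment> \<open>One factor \<epsilon> is distributed to each of the two factors of the
    numerator.\<close>
  let ?R = "\<lambda>\<epsilon>. ((\<epsilon> * g - (\<epsilon> * (\<epsilon> * \<kappa>1 / z \<epsilon>) + \<kappa>2 * z \<epsilon> / \<kappa>1)) *
      (\<epsilon> * gu - (\<epsilon> * (\<epsilon> * \<kappa>1 / z \<epsilon>) + \<kappa>2 * z \<epsilon> / (q * \<kappa>1)))) /
    ((g - qG \<kappa>2 (z \<epsilon>)) * (gu - qG (\<kappa>2 / q) (z \<epsilon>)))"
  have "(?R \<longlongrightarrow> ((0 * g - (0 * (0 * \<kappa>1 / f) + \<kappa>2 * f / \<kappa>1)) *
      (0 * gu - (0 * (0 * \<kappa>1 / f) + \<kappa>2 * f / (q * \<kappa>1)))) /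
     ((g - qG \<kappa>2 f) * (gu - qG (\<kappa>2 / q) f))) (at 0)"
    using nz gen unfolding qG_def by (intro tendsto_intros z) auto
  then have "(?R \<longlongrightarrow> c / A) (at 0)"
    by (simp add: c_def A_def power2_eq_square mult_ac)
  moreover have "\<forall>\<^sub>F \<epsilon> in at 0. ?R \<epsilon> = ?L \<epsilon>"
    using tendsto_imp_eventually_ne[OF z gen(1)] eventually_neq_at_within[of 0 0 UNIV]
  proof eventually_elim
    case (elim \<epsilon>)
    have "\<epsilon> * g - (\<epsilon> * (\<epsilon> * \<kappa>1 / z \<epsilon>) + \<kappa>2 * z \<epsilon> / \<kappa>1) = \<epsilon> * (g - qG \<kappa>2 (\<epsilon> * \<kappa>1 / z \<epsilon>))"
      and "\<epsilon> * gu - (\<epsilon> * (\<epsilon> * \<kappa>1 / z \<epsilon>) + \<kappa>2 * z \<epsilon> / (q * \<kappa>1)) =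
        \<epsilon> * (gu - qG (\<kappa>2 / q) (\<epsilon> * \<kappa>1 / z \<epsilon>))"
      using elim nz by (simp_all add: qG_def right_diff_distrib distrib_left)
    then show ?case by (simp add: power2_eq_square)
  qed
  ultimately have l: "(?L \<longlongrightarrow> c / A) (at 0)"
    by (rule Lim_transform_eventually)
  \<comment> \<open>The constraint turns the constant of the right limit into
    \<open>c * f\<^sup>2\<close>, so that \<open>c\<close> can be cancelled.\<close>
  have "q * (\<Prod>i=1..8. v i) * f ^ 4 = q * (c * f\<^sup>2 * \<kappa>1 ^ 4)"
    unfolding bal[symmetric] c_def using nz
    by (simp add: field_simps eval_nat_numeral)
  then have "f ^ 4 / \<kappa>1 ^ 4 * (\<Prod>i=1..8. v i) = c * f\<^sup>2"
    using nz by (simp add: field_simps)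
  then have r: "((\<lambda>\<epsilon>. \<epsilon>\<^sup>2 * (qU (\<lambda>i. if i \<in> {1..2} then \<epsilon> * v i else v i) (\<epsilon> * \<kappa>1 / z \<epsilon>) /
      qU (\<lambda>i. if i \<in> {1..2} then \<epsilon> * v i else v i) (z \<epsilon>))) \<longlongrightarrow> c * f\<^sup>2 * (B / C)) (at 0)"
    using qU_ratio_scaled_limit[of 2 z f \<kappa>1 v] z nz gen by (simp add: B_def C_def)
  \<comment> \<open>The limits give the reciprocal of the displayed equation; genericity makes all
    quantities nonzero, so it can be inverted.\<close>
  have "c / A = c * f\<^sup>2 * (B / C) \<longleftrightarrow> A = C / (f\<^sup>2 * B)"
    using c ABC gen by (auto simp: field_simps)
  with l r show ?thesis
    unfolding becomes_def E8_eq1_def fst_conv snd_conv A_def B_def C_def by blast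
qed

text \<open>The replacement leaves g = G(z) unchanged, so z is a fixed number. F(z) tends to z, and
  the factors with v_1, v_2 tend to z, or to \<open>w\<close> in the numerator; this lowers the
  fourth power of z / \<open>w\<close> to the square.\<close>

lemma degeneration2_eq2:
  fixes v :: "nat \<Rightarrow> complex"
  assumes nz: "\<kappa>2 \<noteq> 0" "z \<noteq> 0"
    and gen: "f \<noteq> z" "fo \<noteq> z" "\<forall>i\<in>{3..8}. z \<noteq> v i"
  shows "becomes 0
    (\<lambda>\<epsilon>. E8_eq2 q (\<epsilon> * \<kappa>1) \<kappa>2
            (qU (\<lambda>i. if i \<in> {1..2} then \<epsilon> * v i else v i)) f fo z)
    (((f - \<kappa>2 / z) * (fo - \<kappa>2 / z)) / ((f - z) * (fo - z)) =
     z^2 / (\<kappa>2 / z)^2 * ((\<Prod>i=3..8. \<kappa>2 / z - v i) / (\<Prod>i=3..8. z - v i)))"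
proof -
  define w where "w = \<kappa>2 / z"
  have w: "w \<noteq> 0" using nz by (simp add: w_def)
  have "((\<lambda>\<epsilon>. ((f - qF (\<epsilon> * \<kappa>1) w) * (fo - qF (\<epsilon> * \<kappa>1 / q) w)) /
      ((f - qF (\<epsilon> * \<kappa>1) z) * (fo - qF (\<epsilon> * \<kappa>1 / q) z))) \<longlongrightarrow>
     ((f - (w + 0 * \<kappa>1 / w)) * (fo - (w + 0 * \<kappa>1 / q / w))) /
      ((f - (z + 0 * \<kappa>1 / z)) * (fo - (z + 0 * \<kappa>1 / q / z)))) (at 0)"
    \<comment> \<open>Division by q becomes multiplication by a constant, so the limit rule for
      products handles it.\<close>
    unfolding divide_inverse[of _ q] qF_def using nz w gen by (intro tendsto_intros) auto
  then have l: "((\<lambda>\<epsilon>. ((f - qF (\<epsilon> * \<kappa>1) w) * (fo - qF (\<epsilon> * \<kappa>1 / q) w)) /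
      ((f - qF (\<epsilon> * \<kappa>1) z) * (fo - qF (\<epsilon> * \<kappa>1 / q) z))) \<longlongrightarrow>
     ((f - w) * (fo - w)) / ((f - z) * (fo - z))) (at 0)"
    by simp
  have "((\<lambda>\<epsilon>. (z / w) ^ 4 *
      ((\<Prod>i=1..2. w - \<epsilon> * v i) * (\<Prod>i=Suc 2..8. w - v i) /
       ((\<Prod>i=1..2. z - \<epsilon> * v i) * (\<Prod>i=Suc 2..8. z - v i)))) \<longlongrightarrow>
     (z / w) ^ 4 * ((\<Prod>i=1..2. w - 0 * v i) * (\<Prod>i=Suc 2..8. w - v i) /
       ((\<Prod>i=1..2. z - 0 * v i) * (\<Prod>i=Suc 2..8. z - v i)))) (at 0)"
    using nz w gen by (intro tendsto_intros) auto
  also have "(z / w) ^ 4 * ((\<Prod>i=1..2. w - 0 * v i) * (\<Prod>i=Suc 2..8. w - v i) /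
       ((\<Prod>i=1..2. z - 0 * v i) * (\<Prod>i=Suc 2..8. z - v i))) =
     z\<^sup>2 / w\<^sup>2 * ((\<Prod>i=3..8. w - v i) / (\<Prod>i=3..8. z - v i))"
    using nz w by (simp add: power_divide power4_eq_xxxx power2_eq_square mult_ac)
  finally have r: "((\<lambda>\<epsilon>. qU (\<lambda>i. if i \<in> {1..2} then \<epsilon> * v i else v i) w /
      qU (\<lambda>i. if i \<in> {1..2} then \<epsilon> * v i else v i) z) \<longlongrightarrow>
     z\<^sup>2 / w\<^sup>2 * ((\<Prod>i=3..8. w - v i) / (\<Prod>i=3..8. z - v i))) (at 0)"
    unfolding qU_ratio by (simp only: prod_scaled_split)
  from l r show ?thesis
    unfolding becomes_def E8_eq2_def fst_conv snd_conv power_0 mult_1_left w_def by blast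
qed

section \<open>Degeneration (3): v_1 and v_2 scaled inversely\<close>

text \<open>Multiplying numerator and denominator by \<epsilon> turns the divergent factors x - v_2
  / \<epsilon> into \<epsilon> x - v_2, whose common limit -v_2 cancels.\<close>

lemma qU_ratio_degeneration3:
  fixes v :: "nat \<Rightarrow> complex"
  assumes nz: "v 2 \<noteq> 0" "w \<noteq> 0" "z \<noteq> 0" and gen: "\<forall>i\<in>{3..8}. z \<noteq> v i"
  shows "((\<lambda>\<epsilon>. qU (v(1 := \<epsilon> * v 1, 2 := inverse \<epsilon> * v 2)) w /
      qU (v(1 := \<epsilon> * v 1, 2 := inverse \<epsilon> * v 2)) z) \<longlongrightarrow>
    (w powi (-3) * (\<Prod>i=3..8. w - v i)) / (z powi (-3) * (\<Prod>i=3..8. z - v i))) (at 0)"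
    (is "(?L \<longlongrightarrow> ?l) _")
proof -
  let ?R = "\<lambda>\<epsilon>. (z / w) ^ 4 * (((w - \<epsilon> * v 1) * (\<epsilon> * w - v 2) * (\<Prod>i=3..8. w - v i)) /
    ((z - \<epsilon> * v 1) * (\<epsilon> * z - v 2) * (\<Prod>i=3..8. z - v i)))"
  have "(?R \<longlongrightarrow> (z / w) ^ 4 * (((w - 0 * v 1) * (0 * w - v 2) * (\<Prod>i=3..8. w - v i)) /
    ((z - 0 * v 1) * (0 * z - v 2) * (\<Prod>i=3..8. z - v i)))) (at 0)"
    using nz gen by (intro tendsto_intros) auto
  also have "(z / w) ^ 4 * (((w - 0 * v 1) * (0 * w - v 2) * (\<Prod>i=3..8. w - v i)) /
    ((z - 0 * v 1) * (0 * z - v 2) * (\<Prod>i=3..8. z - v i))) = ?l"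
    using nz by (simp add: power_divide power_int_minus power4_eq_xxxx power3_eq_cube field_simps)
  finally have "(?R \<longlongrightarrow> ?l) (at 0)" .
  moreover have "\<forall>\<^sub>F \<epsilon> in at 0. ?R \<epsilon> = ?L \<epsilon>"
    using eventually_neq_at_within[of 0 0 UNIV]
  proof eventually_elim
    case (elim \<epsilon>)
    have "{1..8} = insert 1 (insert 2 {3..8::nat})" by auto
    then have split: "(\<Prod>i=1..8. x - (v(1 := \<epsilon> * v 1, 2 := inverse \<epsilon> * v 2)) i) =
      inverse \<epsilon> * ((x - \<epsilon> * v 1) * (\<epsilon> * x - v 2) * (\<Prod>i=3..8. x - v i))" for x
      using elim by (simp add: field_simps)
    show ?case
      unfolding qU_ratio split using elim by simp
  qed
  ultimately show ?thesis
    by (rule Lim_transform_eventually)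
qed

text \<open>The replacement affects U alone, so the left side is constant in \<epsilon> and only the
  right side needs a limit.\<close>

lemma degeneration3_eq1:
  assumes "\<kappa>1 \<noteq> 0" "v 2 \<noteq> 0" "z \<noteq> 0" "\<forall>i\<in>{3..8}. z \<noteq> v i"
  shows "becomes 0
    (\<lambda>\<epsilon>. E8_eq1 q \<kappa>1 \<kappa>2 (qU (v(1 := \<epsilon> * v 1, 2 := inverse \<epsilon> * v 2))) g gu z)
    (holds (E8_eq1 q \<kappa>1 \<kappa>2 (\<lambda>w. w powi (-3) * (\<Prod>i=3..8. w - v i)) g gu z))"
  unfolding becomes_def E8_eq1_def holds_def fst_conv snd_conv power_0 mult_1_left
  using qU_ratio_degeneration3[of v "\<kappa>1 / z" z] assms
  \<comment> \<open>\<open>tendsto_const\<close> fixes the left limit and \<open>refl\<close>,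
    applied to the equivalence, the right one.\<close>
  by (intro exI conjI tendsto_const refl) auto

lemma degeneration3_eq2:
  assumes "\<kappa>2 \<noteq> 0" "v 2 \<noteq> 0" "z \<noteq> 0" "\<forall>i\<in>{3..8}. z \<noteq> v i"
  shows "becomes 0
    (\<lambda>\<epsilon>. E8_eq2 q \<kappa>1 \<kappa>2 (qU (v(1 := \<epsilon> * v 1, 2 := inverse \<epsilon> * v 2))) f fo z)
    (holds (E8_eq2 q \<kappa>1 \<kappa>2 (\<lambda>w. w powi (-3) * (\<Prod>i=3..8. w - v i)) f fo z))"
  unfolding becomes_def E8_eq2_def holds_def fst_conv snd_conv power_0 mult_1_left
  using qU_ratio_degeneration3[of v "\<kappa>2 / z" z] assms
  by (intro exI conjI tendsto_const refl) auto

section \<open>The three degenerations together\<close>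

theorem mainTheorem1:
  fixes q \<kappa>1 \<kappa>2 :: complex and v :: "nat \<Rightarrow> complex"
  assumes "q \<noteq> 0" and "\<kappa>1 \<noteq> 0" and "\<kappa>2 \<noteq> 0" and "\<forall>i\<in>{1..8}. v i \<noteq> 0"
    and "\<kappa>1^2 * \<kappa>2^2 = q * (\<Prod>i=1..8. v i)"
  shows
    "(\<forall>f g gu. f \<noteq> 0 \<and> g \<noteq> 0 \<and> gu \<noteq> 0 \<and> f * g \<noteq> 1 \<and> f * gu \<noteq> 1 \<and> (\<forall>i\<in>{5..8}. f \<noteq> v i) \<longrightarrow>
       (\<exists>z. nonzero_root (\<lambda>\<epsilon>. qF (\<epsilon> * \<kappa>1)) f z) \<and>
       (\<forall>z. nonzero_root (\<lambda>\<epsilon>. qF (\<epsilon> * \<kappa>1)) f z \<longrightarrow>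
          becomes 0
            (\<lambda>\<epsilon>. E8_eq1 q (\<epsilon> * \<kappa>1) (\<epsilon> * \<kappa>2)
                    (qU (\<lambda>j. if j \<in> {1..4} then \<epsilon> * v j else v j)) (1 / g) (1 / gu) (z \<epsilon>))
            (((f * g - \<kappa>1 / \<kappa>2) * (f * gu - q * \<kappa>1 / \<kappa>2)) / ((f * g - 1) * (f * gu - 1)) =
             (\<Prod>i=1..4. f - \<kappa>1 / v i) / (\<Prod>i=5..8. f - v i)))) \<and>
     (\<forall>f fo g. g \<noteq> 0 \<and> f * g \<noteq> 1 \<and> fo * g \<noteq> 1 \<and> (\<forall>i\<in>{5..8}. g \<noteq> 1 / v i) \<longrightarrow>
       (\<exists>z. nonzero_root (\<lambda>\<epsilon>. qG (\<epsilon> * \<kappa>2)) (1 / g) z) \<and>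
       (\<forall>z. nonzero_root (\<lambda>\<epsilon>. qG (\<epsilon> * \<kappa>2)) (1 / g) z \<longrightarrow>
          becomes 0
            (\<lambda>\<epsilon>. E8_eq2 q (\<epsilon> * \<kappa>1) (\<epsilon> * \<kappa>2)
                    (qU (\<lambda>j. if j \<in> {1..4} then \<epsilon> * v j else v j)) f fo (z \<epsilon>))
            (((f * g - \<kappa>1 / \<kappa>2) * (fo * g - \<kappa>1 / (q * \<kappa>2))) / ((f * g - 1) * (fo * g - 1)) =
             (\<Prod>i=1..4. g - v i / \<kappa>2) / (\<Prod>i=5..8. g - 1 / v i)))) \<and>
     (\<forall>f g gu. f \<noteq> 0 \<and> g \<noteq> qG \<kappa>2 f \<and> gu \<noteq> qG (\<kappa>2 / q) f \<and>
         (\<forall>i\<in>{1..2}. f \<noteq> \<kappa>1 / v i) \<and> (\<forall>i\<in>{3..8}. f \<noteq> v i) \<longrightarrow>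
       (\<exists>z. nonzero_root (\<lambda>\<epsilon>. qF (\<epsilon> * \<kappa>1)) f z) \<and>
       (\<forall>z. nonzero_root (\<lambda>\<epsilon>. qF (\<epsilon> * \<kappa>1)) f z \<longrightarrow>
          becomes 2
            (\<lambda>\<epsilon>. E8_eq1 q (\<epsilon> * \<kappa>1) \<kappa>2
                    (qU (\<lambda>i. if i \<in> {1..2} then \<epsilon> * v i else v i)) g gu (z \<epsilon>))
            ((g - qG \<kappa>2 f) * (gu - qG (\<kappa>2 / q) f) =
             (\<Prod>i=3..8. f - v i) / (f^2 * (\<Prod>i=1..2. f - \<kappa>1 / v i))))) \<and>
     (\<forall>f fo g z. z \<noteq> 0 \<and> g = qG \<kappa>2 z \<and> f \<noteq> z \<and> fo \<noteq> z \<and> (\<forall>i\<in>{3..8}. z \<noteq> v i) \<longrightarrow>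
       becomes 0
         (\<lambda>\<epsilon>. E8_eq2 q (\<epsilon> * \<kappa>1) \<kappa>2
                 (qU (\<lambda>i. if i \<in> {1..2} then \<epsilon> * v i else v i)) f fo z)
         (((f - \<kappa>2 / z) * (fo - \<kappa>2 / z)) / ((f - z) * (fo - z)) =
          z^2 / (\<kappa>2 / z)^2 * ((\<Prod>i=3..8. \<kappa>2 / z - v i) / (\<Prod>i=3..8. z - v i)))) \<and>
     (\<forall>f g gu z. z \<noteq> 0 \<and> f = qF \<kappa>1 z \<and> g \<noteq> qG \<kappa>2 z \<and> gu \<noteq> qG (\<kappa>2 / q) z \<and>
         (\<forall>i\<in>{3..8}. z \<noteq> v i) \<longrightarrow>
       becomes 0
         (\<lambda>\<epsilon>. E8_eq1 q \<kappa>1 \<kappa>2 (qU (v(1 := \<epsilon> * v 1, 2 := inverse \<epsilon> * v 2))) g gu z)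
         (holds (E8_eq1 q \<kappa>1 \<kappa>2 (\<lambda>w. w powi (-3) * (\<Prod>i=3..8. w - v i)) g gu z))) \<and>
     (\<forall>f fo g z. z \<noteq> 0 \<and> g = qG \<kappa>2 z \<and> f \<noteq> qF \<kappa>1 z \<and> fo \<noteq> qF (\<kappa>1 / q) z \<and>
         (\<forall>i\<in>{3..8}. z \<noteq> v i) \<longrightarrow>
       becomes 0
         (\<lambda>\<epsilon>. E8_eq2 q \<kappa>1 \<kappa>2 (qU (v(1 := \<epsilon> * v 1, 2 := inverse \<epsilon> * v 2))) f fo z)
         (holds (E8_eq2 q \<kappa>1 \<kappa>2 (\<lambda>w. w powi (-3) * (\<Prod>i=3..8. w - v i)) f fo z)))"
  \<comment> \<open>Each conjunct is the existence of a root branch or one of the six limits. For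
    the second equation of (1) the branch is the one tending to 1 / g, obtained from the result for
    \<open>qF\<close> by folding.\<close>
  by (intro conjI allI impI; elim conjE;
      rule nonzero_root_exists nonzero_root_exists[folded qG_eq_qF]
        degeneration1_eq1 degeneration1_eq2 degeneration2_eq1 degeneration2_eq2
        degeneration3_eq1 degeneration3_eq2;
      (assumption | rule assms | simp add: assms))

end
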